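(* Let $m\ge2$ and $0<\alpha<1$. An arithmetic box space $\square_{(G_m(N_k))_k}G_m$ has property $D_\alpha$ if and only if there is a constant $c>0$ such that $\operatorname{ord}_m(N_k)\ge c\,N_k^{\alpha/(1-\alpha)}$ for all $k$.
   Context: $G_m$ is the subgroup of $GL_2(\mathbb Z[1/m])$ of matrices $\begin{pmatrix} m^k & r\\ 0&1\end{pmatrix}$, $k\in\mathbb Z$, $r\in\mathbb Z[1/m]$, generated by $A=\begin{pmatrix}1&1\\0&1\end{pmatrix}$, $T=\begin{pmatrix}m&0\\0&1\end{pmatrix}$. For $N$ coprime to $m$, $G_m(N)$ is the kernel of reduction modulo $N$, $G_m\to GL_2(\mathbb Z/N\mathbb Z)$, and $\operatorname{ord}_m(N)$ is the multiplicative order of $m$ modulo $N$. An arithmetic box space of $G_m$ is the family of Cayley graphs $\mathrm{Cay}(G_m/G_m(N_k),\{A,T\})$ where $(N_k)$ is a strictly increasing sequence of integers $\ge2$ coprime to $m$ with $N_k\mid N_{k+1}$. It has property $D_\alpha$ if there is $C>0$ with $\operatorname{diam}\mathrm{Cay}(G_m/G_m(N_k),\{A,T\})\ge C|G_m/G_m(N_k)|^\alpha$ for all $k$. *)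

theory Defs
  imports "HOL-Analysis.Analysis" "HOL-Number_Theory.Number_Theory"
begin

type_synonym qmat = "rat^2^2"

definition mat2 :: "rat \<Rightarrow> rat \<Rightarrow> rat \<Rightarrow> rat \<Rightarrow> qmat" where
  "mat2 a b c d = vector [vector [a, b], vector [c, d]]"

text \<open>The ring Z[1/m] inside the rationals.\<close>
definition Zinv :: "nat \<Rightarrow> rat set" where
  "Zinv m = {q. \<exists>a::int. \<exists>j::nat. q = of_int a / of_nat m ^ j}"

text \<open>G_m: matrices (m^k, r; 0, 1) with k in Z and r in Z[1/m].\<close>
definition Gm :: "nat \<Rightarrow> qmat set" where
  "Gm m = {mat2 (of_nat m powi k) r 0 1 | k r. r \<in> Zinv m}"

definition genA :: qmat where "genA = mat2 1 1 0 1"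
definition genT :: "nat \<Rightarrow> qmat" where "genT m = mat2 (of_nat m) 0 0 1"

text \<open>Symmetric generating set: A, T and their inverses (undirected Cayley graph).\<close>
definition gens :: "nat \<Rightarrow> qmat set" where
  "gens m = {genA, mat2 1 (-1) 0 1, genT m, mat2 (1 / of_nat m) 0 0 1}"

text \<open>Congruence mod N in Z[1/m]: difference lies in the ideal N Z[1/m].
  Since N is coprime to m, this is exactly equality after reduction Z[1/m] -> Z/NZ.\<close>
definition congZ :: "nat \<Rightarrow> nat \<Rightarrow> rat \<Rightarrow> rat \<Rightarrow> bool" where
  "congZ m N x y \<longleftrightarrow> (\<exists>z \<in> Zinv m. x - y = of_nat N * z)"

text \<open>G_m(N): kernel of reduction modulo N.\<close>
definition GmN :: "nat \<Rightarrow> nat \<Rightarrow> qmat set" where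
  "GmN m N = {g \<in> Gm m. \<forall>i j. congZ m N (g $ i $ j) (mat 1 $ i $ j)}"

definition lcoset :: "nat \<Rightarrow> nat \<Rightarrow> qmat \<Rightarrow> qmat set" where
  "lcoset m N g = (\<lambda>h. g ** h) ` GmN m N"

text \<open>The quotient G_m / G_m(N) as a set of cosets.\<close>
definition quot :: "nat \<Rightarrow> nat \<Rightarrow> qmat set set" where
  "quot m N = lcoset m N ` Gm m"

text \<open>Graph distance in Cay(G_m/G_m(N), {A,T}) between the cosets of g and g'.\<close>
definition cay_dist :: "nat \<Rightarrow> nat \<Rightarrow> qmat \<Rightarrow> qmat \<Rightarrow> nat" where
  "cay_dist m N g g' = (LEAST n. \<exists>w. length w = n \<and> set w \<subseteq> gens m \<and>
       lcoset m N (foldl (**) g w) = lcoset m N g')"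

definition cay_diam :: "nat \<Rightarrow> nat \<Rightarrow> nat" where
  "cay_diam m N = Sup {cay_dist m N g g' | g g'. g \<in> Gm m \<and> g' \<in> Gm m}"

definition arith_box_seq :: "nat \<Rightarrow> (nat \<Rightarrow> nat) \<Rightarrow> bool" where
  "arith_box_seq m N \<longleftrightarrow> strict_mono N \<and> (\<forall>k. N k \<ge> 2 \<and> coprime (N k) m \<and> N k dvd N (Suc k))"

definition property_D :: "real \<Rightarrow> nat \<Rightarrow> (nat \<Rightarrow> nat) \<Rightarrow> bool" where
  "property_D \<alpha> m N \<longleftrightarrow> (\<exists>C>0. \<forall>k. real (cay_diam m (N k)) \<ge> C * real (card (quot m (N k))) powr \<alpha>)"

end

theory Submission
  imports Defs
begin

(* Modulo N the group G_m becomes the affine group x \<mapsto> m^i x + t over Z/NZ, with i taken modulo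
   ord_m(N), so the quotient has ord_m(N) N elements. Its diameter is comparable to ord_m(N): any
   element is reached by spelling t < N < m^ord_m(N) in base m, interleaved with ord_m(N) letters T,
   which costs at most (m + 1) ord_m(N) letters; conversely every letter changes the exponent i by
   at most one, so T^(ord_m(N)/2) lies at distance about ord_m(N)/2. Hence
   diam \<ge> C (ord_m(N) N)^\<alpha> amounts to ord_m(N)^(1-\<alpha>) \<ge> C' N^\<alpha>. *)

lemma mat2_eq_iff: "mat2 a b c d = mat2 a' b' c' d' \<longleftrightarrow> a = a' \<and> b = b' \<and> c = c' \<and> d = d'"
  by (simp add: mat2_def vec_eq_iff forall_2)

lemma mat2_mult:
  "mat2 a b c d ** mat2 a' b' c' d' = mat2 (a*a' + b*c') (a*b' + b*d') (c*a' + d*c') (c*b' + d*d')"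
  by (simp add: mat2_def matrix_matrix_mult_def vec_eq_iff forall_2 sum_2)

lemma mat_1_eq_mat2: "(mat 1 :: qmat) = mat2 1 0 0 1"
  by (simp add: mat2_def mat_def vec_eq_iff forall_2)

lemma mat2_nth:
  "mat2 a b c d $ 1 $ 1 = a" "mat2 a b c d $ 1 $ 2 = b" "mat2 a b c d $ 2 $ 1 = c" "mat2 a b c d $ 2 $ 2 = d"
  by (simp_all add: mat2_def)

subsection \<open>The ring Z[1/m] and its ideal N Z[1/m]\<close>

lemma Zinv_of_int: "of_int a \<in> Zinv m"
  unfolding Zinv_def by (rule CollectI, rule exI[of _ a], rule exI[of _ 0]) simp

lemma Zinv_of_nat: "of_nat a \<in> Zinv m"
  using Zinv_of_int[of "int a" m] by simp

lemma Zinv_add: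
  assumes "m > 0" "x \<in> Zinv m" "y \<in> Zinv m"
  shows "x + y \<in> Zinv m"
proof -
  obtain a i b j where x: "x = of_int a / of_nat m ^ i" and y: "y = of_int b / of_nat m ^ j"
    using assms unfolding Zinv_def by blast
  have "x + y = of_int (a * int m ^ j + b * int m ^ i) / of_nat m ^ (i + j)"
    using assms(1) by (simp add: x y field_simps power_add)
  then show ?thesis unfolding Zinv_def by blast
qed

lemma Zinv_mult:
  assumes "x \<in> Zinv m" "y \<in> Zinv m"
  shows "x * y \<in> Zinv m"
proof -
  obtain a i b j where x: "x = of_int a / of_nat m ^ i" and y: "y = of_int b / of_nat m ^ j"
    using assms unfolding Zinv_def by blast
  have "x * y = of_int (a * b) / of_nat m ^ (i + j)"
    by (simp add: x y power_add)
  then show ?thesis unfolding Zinv_def by blast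
qed

lemma Zinv_uminus: "x \<in> Zinv m \<Longrightarrow> - x \<in> Zinv m"
  using Zinv_mult[OF Zinv_of_int[of "-1"]] by simp

lemma Zinv_diff: "m > 0 \<Longrightarrow> x \<in> Zinv m \<Longrightarrow> y \<in> Zinv m \<Longrightarrow> x - y \<in> Zinv m"
  using Zinv_add[OF _ _ Zinv_uminus] by fastforce

lemma Zinv_powi:
  assumes "m > 0"
  shows "of_nat m powi k \<in> Zinv m"
proof (cases "k \<ge> 0")
  case True
  then have "(of_nat m powi k :: rat) = of_nat (m ^ nat k)"
    by (simp add: power_int_def)
  then show ?thesis using Zinv_of_nat by metis
next
  case False
  then have "(of_nat m powi k :: rat) = of_int 1 / of_nat m ^ nat (- k)"
    by (simp add: power_int_def divide_inverse power_inverse)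
  then show ?thesis unfolding Zinv_def by blast
qed

lemma Zinv_powi_mult: "m > 0 \<Longrightarrow> r \<in> Zinv m \<Longrightarrow> of_nat m powi k * r \<in> Zinv m"
  by (rule Zinv_mult[OF Zinv_powi])

definition NZinv :: "nat \<Rightarrow> nat \<Rightarrow> rat set" where
  "NZinv m N = (\<lambda>z. of_nat N * z) ` Zinv m"

lemma congZ_iff_NZinv: "congZ m N x y \<longleftrightarrow> x - y \<in> NZinv m N"
  by (auto simp: congZ_def NZinv_def)

lemma NZinv_add:
  assumes "m > 0" "x \<in> NZinv m N" "y \<in> NZinv m N"
  shows "x + y \<in> NZinv m N"
proof -
  obtain z w where "z \<in> Zinv m" "w \<in> Zinv m" "x = of_nat N * z" "y = of_nat N * w"
    using assms unfolding NZinv_def by blast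
  then show ?thesis
    unfolding NZinv_def using Zinv_add[OF assms(1)] by (auto simp: distrib_left[symmetric])
qed

lemma NZinv_mult_Zinv: "x \<in> NZinv m N \<Longrightarrow> u \<in> Zinv m \<Longrightarrow> x * u \<in> NZinv m N"
  unfolding NZinv_def using Zinv_mult by (fastforce simp: mult.assoc)

lemma NZinv_uminus: "x \<in> NZinv m N \<Longrightarrow> - x \<in> NZinv m N"
  using NZinv_mult_Zinv[OF _ Zinv_of_int[of "-1"]] by fastforce

lemma NZinv_uminus_iff: "- x \<in> NZinv m N \<longleftrightarrow> x \<in> NZinv m N"
  by (metis NZinv_uminus minus_minus)

lemma NZinv_diff: "m > 0 \<Longrightarrow> x \<in> NZinv m N \<Longrightarrow> y \<in> NZinv m N \<Longrightarrow> x - y \<in> NZinv m N"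
  using NZinv_add[OF _ _ NZinv_uminus] by fastforce

lemma zero_in_NZinv: "0 \<in> NZinv m N"
  unfolding NZinv_def using Zinv_of_int[of 0 m] by force

lemma of_int_multiple_in_NZinv: "of_int (int N * c) \<in> NZinv m N"
  unfolding NZinv_def using Zinv_of_int[of c m] by force

lemma NZinv_mult_powi_iff:
  assumes "m > 0"
  shows "x * of_nat m powi i \<in> NZinv m N \<longleftrightarrow> x \<in> NZinv m N"
proof
  assume "x * of_nat m powi i \<in> NZinv m N"
  from NZinv_mult_Zinv[OF this Zinv_powi[OF assms, of "-i"]]
  show "x \<in> NZinv m N" using assms by (simp add: power_int_minus mult.assoc)
qed (rule NZinv_mult_Zinv[OF _ Zinv_powi[OF assms]])

lemma of_int_in_NZinv_iff:
  assumes "coprime N m"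
  shows "of_int t \<in> NZinv m N \<longleftrightarrow> int N dvd t"
proof
  assume "int N dvd t"
  then show "of_int t \<in> NZinv m N" using of_int_multiple_in_NZinv by auto
next
  assume "of_int t \<in> NZinv m N"
  then obtain a j where "(of_int t :: rat) = of_nat N * (of_int a / of_nat m ^ j)"
    unfolding NZinv_def Zinv_def by blast
  then have "(of_int t :: rat) * of_nat m ^ j = of_nat N * of_int a \<or> m = 0"
    by (cases "m = 0") (auto simp: field_simps)
  then have "t * int m ^ j = int N * a \<or> m = 0"
    by (metis (mono_tags) of_int_eq_iff of_int_mult of_int_of_nat_eq of_int_power)
  then show "int N dvd t"
  proof
    assume "t * int m ^ j = int N * a"
    moreover have "coprime (int N) (int m ^ j)" using assms by simp
    ultimately show ?thesis by (metis coprime_dvd_mult_left_iff dvd_triv_left)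
  next
    assume "m = 0"
    then show ?thesis using assms by simp
  qed
qed

lemma powi_minus_1_in_NZinv_iff:
  assumes "m \<ge> 2" "coprime N m"
  shows "of_nat m powi j - 1 \<in> NZinv m N \<longleftrightarrow> int (ord N m) dvd j"
proof -
  have power_case: "(of_nat m ^ n - 1 :: rat) \<in> NZinv m N \<longleftrightarrow> ord N m dvd n" for n
  proof -
    have e: "(of_nat m ^ n - 1 :: rat) = of_int (int m ^ n - 1)" by simp
    have "(of_nat m ^ n - 1 :: rat) \<in> NZinv m N \<longleftrightarrow> int N dvd int m ^ n - 1"
      unfolding e by (rule of_int_in_NZinv_iff[OF assms(2)])
    also have "\<dots> \<longleftrightarrow> [m ^ n = 1] (mod N)"
      by (metis cong_iff_dvd_diff cong_int_iff int_ops(2) of_nat_power)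
    also have "\<dots> \<longleftrightarrow> ord N m dvd n" by (rule ord_divides)
    finally show ?thesis .
  qed
  show ?thesis
  proof (cases "j \<ge> 0")
    case True
    then obtain n where "j = int n" using nonneg_eq_int by blast
    then show ?thesis using power_case[of n] by simp
  next
    case False
    define n where "n = nat (- j)"
    then have j: "j = - int n" using False by simp
    have "(of_nat m powi j - 1) * of_nat m powi int n = - (of_nat m ^ n - 1 :: rat)"
      using assms(1) by (simp add: j power_int_minus field_simps)
    then have "of_nat m powi j - 1 \<in> NZinv m N \<longleftrightarrow> - (of_nat m ^ n - 1 :: rat) \<in> NZinv m N"
      using NZinv_mult_powi_iff[of m "of_nat m powi j - 1" "int n" N] assms by simp
    also have "\<dots> \<longleftrightarrow> ord N m dvd n"
      unfolding NZinv_uminus_iff by (rule power_case)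
    finally show ?thesis by (simp add: j)
  qed
qed

lemma ord_pos: "coprime (N::nat) m \<Longrightarrow> ord N m > 0"
  using ord_eq_0[of N m] by simp

text \<open>Since m is invertible modulo N, 1/m^j is congruent to the integer m^((ord N m - 1) j).\<close>

lemma Zinv_cong_nat:
  assumes "m \<ge> 2" "coprime N m" "q \<in> Zinv m"
  obtains t where "t < N" "q - of_nat t \<in> NZinv m N"
proof -
  obtain a j where q: "q = of_int a / of_nat m ^ j" using assms unfolding Zinv_def by blast
  define od where "od = ord N m"
  have "of_nat m powi int (od * j) - 1 \<in> NZinv m N"
    using powi_minus_1_in_NZinv_iff[OF assms(1,2)] unfolding od_def by simp
  then have unit: "(of_nat m ^ (od * j) - 1 :: rat) \<in> NZinv m N" by (metis power_int_of_nat)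
  have "od \<ge> 1" using ord_pos[OF assms(2)] unfolding od_def by linarith
  then have "(of_nat m ^ (od * j) :: rat) = of_nat m ^ j * of_nat m ^ ((od - 1) * j)"
    by (simp add: power_add[symmetric] algebra_simps)
  moreover define b where "b = a * int m ^ ((od - 1) * j)"
  ultimately have qb_eq: "q - of_int b = - (of_nat m ^ (od * j) - 1) * (of_int a / of_nat m ^ j)"
    using assms(1) by (simp add: q b_def field_simps)
  have qb: "q - of_int b \<in> NZinv m N"
    unfolding qb_eq by (rule NZinv_mult_Zinv[OF NZinv_uminus[OF unit]]) (auto simp: Zinv_def)
  have "N > 0" using assms(1,2) by (cases "N = 0") auto
  define t where "t = nat (b mod int N)"
  have "t < N" unfolding t_def using \<open>N > 0\<close> by (simp add: nat_less_iff)
  have "b = int N * (b div int N) + int t" unfolding t_def using \<open>N > 0\<close> by simp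
  then have "(of_int b :: rat) - of_nat t = of_int (int N * (b div int N))"
    by (metis add_diff_cancel_right' of_int_diff of_int_of_nat_eq)
  then have "(of_int b :: rat) - of_nat t \<in> NZinv m N" using of_int_multiple_in_NZinv by simp
  then have "q - of_nat t \<in> NZinv m N"
    using NZinv_add[OF _ qb] assms(1) by fastforce
  with \<open>t < N\<close> show ?thesis by (rule that)
qed

subsection \<open>Elements of G_m and the cosets of G_m(N)\<close>

definition Gm_mat :: "nat \<Rightarrow> int \<Rightarrow> rat \<Rightarrow> qmat" where
  "Gm_mat m k r = mat2 (of_nat m powi k) r 0 1"

lemma powi_eq_iff:
  assumes "m \<ge> 2"
  shows "(of_nat m powi k :: rat) = of_nat m powi k' \<longleftrightarrow> k = k'"
proof -
  have "strict_mono (\<lambda>k. of_nat m powi k :: rat)"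
    using assms by (intro strict_monoI power_int_strict_increasing) auto
  then show ?thesis by (simp add: strict_mono_eq)
qed

lemma Gm_mat_eq_iff: "m \<ge> 2 \<Longrightarrow> Gm_mat m k r = Gm_mat m k' r' \<longleftrightarrow> k = k' \<and> r = r'"
  unfolding Gm_mat_def mat2_eq_iff by (simp add: powi_eq_iff)

lemma Gm_mat_mult:
  "m > 0 \<Longrightarrow> Gm_mat m k r ** Gm_mat m k' r' = Gm_mat m (k + k') (of_nat m powi k * r' + r)"
  unfolding Gm_mat_def mat2_mult by (simp add: power_int_add)

lemma mem_Gm_iff: "g \<in> Gm m \<longleftrightarrow> (\<exists>k r. r \<in> Zinv m \<and> g = Gm_mat m k r)"
  unfolding Gm_def Gm_mat_def by auto

lemma Gm_mat_mem_Gm_iff: "m \<ge> 2 \<Longrightarrow> Gm_mat m k r \<in> Gm m \<longleftrightarrow> r \<in> Zinv m"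
  unfolding mem_Gm_iff using Gm_mat_eq_iff by auto

lemma Gm_mat_mem_GmN_iff:
  assumes "m \<ge> 2"
  shows "Gm_mat m j s \<in> GmN m N \<longleftrightarrow>
    s \<in> Zinv m \<and> of_nat m powi j - 1 \<in> NZinv m N \<and> s \<in> NZinv m N"
proof -
  have "Gm_mat m j s \<in> GmN m N \<longleftrightarrow> s \<in> Zinv m \<and> congZ m N (of_nat m powi j) 1 \<and> congZ m N s 0
     \<and> congZ m N 0 0 \<and> congZ m N 1 1"
    unfolding GmN_def mem_Collect_eq Gm_mat_mem_Gm_iff[OF assms] forall_2 mat_1_eq_mat2
    by (simp add: Gm_mat_def mat2_nth)
  then show ?thesis unfolding congZ_iff_NZinv using zero_in_NZinv by simp
qed

lemma lcoset_Gm_mat: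
  assumes "m \<ge> 2" "coprime N m" "r \<in> Zinv m"
  shows "lcoset m N (Gm_mat m k r) = {Gm_mat m k' r' | k' r'.
    r' \<in> Zinv m \<and> int (ord N m) dvd k' - k \<and> r' - r \<in> NZinv m N}"
  (is "_ = ?S")
proof
  have m0: "m > 0" using assms by simp
  show "lcoset m N (Gm_mat m k r) \<subseteq> ?S"
  proof
    fix x assume "x \<in> lcoset m N (Gm_mat m k r)"
    then obtain j s where h: "Gm_mat m j s \<in> GmN m N" "x = Gm_mat m k r ** Gm_mat m j s"
      unfolding lcoset_def GmN_def mem_Gm_iff by blast
    then have hj: "s \<in> Zinv m" "of_nat m powi j - 1 \<in> NZinv m N" "s \<in> NZinv m N"
      using Gm_mat_mem_GmN_iff[OF assms(1)] by auto
    have "x = Gm_mat m (k + j) (of_nat m powi k * s + r)" using h Gm_mat_mult[OF m0] by simp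
    moreover have "of_nat m powi k * s + r \<in> Zinv m"
      using Zinv_add[OF m0 Zinv_powi_mult[OF m0 hj(1)] assms(3)] .
    moreover have "int (ord N m) dvd (k + j) - k"
      using hj(2) powi_minus_1_in_NZinv_iff[OF assms(1,2)] by simp
    moreover have "(of_nat m powi k * s + r) - r \<in> NZinv m N"
      using NZinv_mult_Zinv[OF hj(3) Zinv_powi[OF m0, of k]] by (simp add: mult.commute)
    ultimately show "x \<in> ?S" by blast
  qed
  show "?S \<subseteq> lcoset m N (Gm_mat m k r)"
  proof
    fix x assume "x \<in> ?S"
    then obtain k' r' where x: "x = Gm_mat m k' r'" "r' \<in> Zinv m"
      "int (ord N m) dvd k' - k" "r' - r \<in> NZinv m N"
      by blast
    define s where "s = (r' - r) * of_nat m powi (- k)"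
    have "s \<in> Zinv m"
      unfolding s_def using Zinv_mult[OF Zinv_diff[OF m0 x(2) assms(3)] Zinv_powi[OF m0]] .
    moreover have "s \<in> NZinv m N"
      unfolding s_def using NZinv_mult_Zinv[OF x(4) Zinv_powi[OF m0]] .
    moreover have "of_nat m powi (k' - k) - 1 \<in> NZinv m N"
      using x(3) powi_minus_1_in_NZinv_iff[OF assms(1,2)] by simp
    ultimately have "Gm_mat m (k' - k) s \<in> GmN m N"
      using Gm_mat_mem_GmN_iff[OF assms(1)] by simp
    moreover have "Gm_mat m k r ** Gm_mat m (k' - k) s = x"
      using m0 by (simp add: x(1) Gm_mat_mult s_def power_int_minus field_simps)
    ultimately show "x \<in> lcoset m N (Gm_mat m k r)" unfolding lcoset_def by force
  qed
qed

lemma lcoset_Gm_mat_eq_iff: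
  assumes "m \<ge> 2" "coprime N m" "r \<in> Zinv m" "r' \<in> Zinv m"
  shows "lcoset m N (Gm_mat m k r) = lcoset m N (Gm_mat m k' r') \<longleftrightarrow>
    int (ord N m) dvd k - k' \<and> r - r' \<in> NZinv m N"
proof
  assume "lcoset m N (Gm_mat m k r) = lcoset m N (Gm_mat m k' r')"
  moreover have "Gm_mat m k r \<in> lcoset m N (Gm_mat m k r)"
    unfolding lcoset_Gm_mat[OF assms(1,2,3)] using assms(3) zero_in_NZinv by force
  ultimately show "int (ord N m) dvd k - k' \<and> r - r' \<in> NZinv m N"
    unfolding lcoset_Gm_mat[OF assms(1,2,4)] using Gm_mat_eq_iff[OF assms(1)] by auto
next
  have m0: "m > 0" using assms by simp
  assume h: "int (ord N m) dvd k - k' \<and> r - r' \<in> NZinv m N"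
  have "int (ord N m) dvd k'' - k \<and> r'' - r \<in> NZinv m N \<longleftrightarrow>
      int (ord N m) dvd k'' - k' \<and> r'' - r' \<in> NZinv m N" for k'' r''
  proof -
    have "k'' - k' = (k'' - k) + (k - k')" "k'' - k = (k'' - k') - (k - k')" by simp_all
    moreover have "r'' - r' = (r'' - r) + (r - r')" "r'' - r = (r'' - r') - (r - r')" by simp_all
    ultimately show ?thesis using h NZinv_add[OF m0] NZinv_diff[OF m0] by (metis dvd_add dvd_diff)
  qed
  then show "lcoset m N (Gm_mat m k r) = lcoset m N (Gm_mat m k' r')"
    unfolding lcoset_Gm_mat[OF assms(1,2,3)] lcoset_Gm_mat[OF assms(1,2,4)] by blast
qed

text \<open>Each coset has a unique representative (m^i, t; 0, 1) with i < ord N m and t < N.\<close>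

lemma card_quot:
  assumes "m \<ge> 2" "coprime N m"
  shows "card (quot m N) = ord N m * N"
proof -
  define od where "od = ord N m"
  have "od > 0" using ord_pos[OF assms(2)] od_def by simp
  define f where "f = (\<lambda>(i::nat, t::nat). lcoset m N (Gm_mat m (int i) (of_nat t)))"
  have "quot m N = f ` ({0..<od} \<times> {0..<N})"
  proof
    show "quot m N \<subseteq> f ` ({0..<od} \<times> {0..<N})"
    proof
      fix x assume "x \<in> quot m N"
      then obtain k r where x: "x = lcoset m N (Gm_mat m k r)" "r \<in> Zinv m"
        unfolding quot_def by (auto simp: mem_Gm_iff)
      obtain t where t: "t < N" "r - of_nat t \<in> NZinv m N"
        using Zinv_cong_nat[OF assms(1,2) x(2)] by blast
      define i where "i = nat (k mod int od)"
      have "i < od" "int od dvd k - int i"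
        unfolding i_def using \<open>od > 0\<close> by (simp_all add: nat_less_iff mod_eq_dvd_iff[symmetric])
      then have "x = f (i, t)"
        using lcoset_Gm_mat_eq_iff[OF assms(1,2) x(2) Zinv_of_nat] t x(1) by (simp add: f_def od_def)
      then show "x \<in> f ` ({0..<od} \<times> {0..<N})" using \<open>i < od\<close> t(1) by force
    qed
    show "f ` ({0..<od} \<times> {0..<N}) \<subseteq> quot m N"
      unfolding f_def quot_def using Gm_mat_mem_Gm_iff[OF assms(1)] Zinv_of_nat by auto
  qed
  moreover have "inj_on f ({0..<od} \<times> {0..<N})"
  proof (rule inj_onI)
    fix a b assume ab: "a \<in> {0..<od} \<times> {0..<N}" "b \<in> {0..<od} \<times> {0..<N}" "f a = f b"
    obtain i t i' t' where a: "a = (i, t)" and b: "b = (i', t')" by fastforce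
    have "int od dvd int i - int i'" "(of_int (int t - int t') :: rat) \<in> NZinv m N"
      using ab(3) lcoset_Gm_mat_eq_iff[OF assms(1,2) Zinv_of_nat Zinv_of_nat]
      by (auto simp: a b f_def od_def)
    then have "int i mod int od = int i' mod int od" "int t mod int N = int t' mod int N"
      using of_int_in_NZinv_iff[OF assms(2), of "int t - int t'"] by (simp_all add: mod_eq_dvd_iff)
    then show "a = b" using ab(1,2) by (simp add: a b)
  qed
  ultimately show ?thesis by (simp add: card_image od_def)
qed

subsection \<open>Words in the generators\<close>

lemma foldl_matrix_mult:
  fixes g :: "'a::comm_semiring_1^'n^'n"
  shows "foldl (**) g w = g ** foldl (**) (mat 1) w"
proof (induction w arbitrary: g)
  case Nil
  then show ?case by (simp add: matrix_mul_rid)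
next
  case (Cons x w)
  have "foldl (**) g (x # w) = (g ** x) ** foldl (**) (mat 1) w"
    using Cons.IH[of "g ** x"] by simp
  also have "\<dots> = g ** (((mat 1) ** x) ** foldl (**) (mat 1) w)"
    by (simp add: matrix_mul_assoc matrix_mul_lid)
  also have "\<dots> = g ** foldl (**) (mat 1) (x # w)"
    using Cons.IH[of "mat 1 ** x"] by simp
  finally show ?case .
qed

lemma mat_1_eq_Gm_mat: "(mat 1 :: qmat) = Gm_mat m 0 0"
  unfolding mat_1_eq_mat2 Gm_mat_def by simp

lemma genA_eq_Gm_mat: "genA = Gm_mat m 0 1"
  unfolding genA_def Gm_mat_def by simp

lemma genT_eq_Gm_mat: "genT m = Gm_mat m 1 0"
  unfolding genT_def Gm_mat_def by simp

lemma gens_eq_Gm_mat: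
  assumes "x \<in> gens m"
  obtains d r where "x = Gm_mat m d r" "\<bar>d\<bar> \<le> 1" "r \<in> Zinv m"
proof -
  have "mat2 1 (-1) 0 1 = Gm_mat m 0 (-1)" "mat2 (1 / of_nat m) 0 0 1 = Gm_mat m (-1) 0"
    by (simp_all add: Gm_mat_def power_int_minus divide_inverse)
  moreover have "(1::rat) \<in> Zinv m" "(-1::rat) \<in> Zinv m" "(0::rat) \<in> Zinv m"
    using Zinv_of_int[of 1 m] Zinv_of_int[of "-1" m] Zinv_of_int[of 0 m] by auto
  ultimately show ?thesis
    using assms that unfolding gens_def genA_eq_Gm_mat[of m] genT_eq_Gm_mat by fastforce
qed

lemma foldl_gens_Gm_mat:
  assumes "m \<ge> 2" "set w \<subseteq> gens m" "r \<in> Zinv m"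
  obtains e s where "foldl (**) (Gm_mat m k r) w = Gm_mat m e s" "\<bar>e - k\<bar> \<le> int (length w)" "s \<in> Zinv m"
  using assms(2,3)
proof (induction w arbitrary: k r)
  case Nil
  then show ?case by fastforce
next
  case (Cons x w)
  have m0: "m > 0" using assms by simp
  obtain d r' where x: "x = Gm_mat m d r'" "\<bar>d\<bar> \<le> 1" "r' \<in> Zinv m"
    using gens_eq_Gm_mat Cons.prems(2) by (metis insert_subset list.simps(15))
  have "foldl (**) (Gm_mat m k r) (x # w) = foldl (**) (Gm_mat m (k + d) (of_nat m powi k * r' + r)) w"
    using x Gm_mat_mult[OF m0] by simp
  moreover have "of_nat m powi k * r' + r \<in> Zinv m"
    using Zinv_add[OF m0 Zinv_powi_mult[OF m0 x(3)] Cons.prems(3)] .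
  ultimately show ?case
    using Cons.IH[of "k + d"] Cons.prems x(2) by fastforce
qed

fun digit_word :: "nat \<Rightarrow> nat \<Rightarrow> nat \<Rightarrow> qmat list" where
  "digit_word m 0 t = []"
| "digit_word m (Suc n) t = replicate (t mod m) genA @ [genT m] @ digit_word m n (t div m)"

lemma foldl_replicate_genA:
  assumes "m > 0"
  shows "foldl (**) (Gm_mat m e b) (replicate d genA) = Gm_mat m e (b + of_nat d * of_nat m powi e)"
proof (induction d arbitrary: b)
  case 0
  then show ?case by simp
next
  case (Suc d)
  have "Gm_mat m e b ** genA = Gm_mat m e (b + of_nat m powi e)"
    unfolding genA_eq_Gm_mat[of m] Gm_mat_mult[OF assms] by (simp add: add.commute)
  then show ?case using Suc.IH by (simp add: algebra_simps)
qed

lemma foldl_replicate_genT: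
  assumes "m > 0"
  shows "foldl (**) (Gm_mat m e b) (replicate d (genT m)) = Gm_mat m (e + int d) b"
proof (induction d arbitrary: e)
  case 0
  then show ?case by simp
next
  case (Suc d)
  have "Gm_mat m e b ** genT m = Gm_mat m (e + 1) b"
    unfolding genT_eq_Gm_mat Gm_mat_mult[OF assms] by simp
  then show ?case using Suc.IH by (simp add: algebra_simps)
qed

lemma foldl_digit_word:
  assumes "m > 0"
  shows "foldl (**) (Gm_mat m (int e) b) (digit_word m n t) =
    Gm_mat m (int (e + n)) (b + of_nat m ^ e * of_nat (t mod m ^ n))"
proof (induction n arbitrary: e b t)
  case 0
  then show ?case by simp
next
  case (Suc n)
  have "t mod m ^ Suc n = m * (t div m mod m ^ n) + t mod m"
    using mod_mult2_eq[of t m "m ^ n"] by simp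
  then have digits: "b + of_nat (t mod m) * of_nat m ^ e + of_nat m ^ (e + 1) * of_nat (t div m mod m ^ n)
      = b + of_nat m ^ e * of_nat (t mod m ^ Suc n)"
    by (simp add: algebra_simps)
  have "foldl (**) (Gm_mat m (int e) b) (digit_word m (Suc n) t) =
      foldl (**) (Gm_mat m (int (e + 1)) (b + of_nat (t mod m) * of_nat m ^ e)) (digit_word m n (t div m))"
    by (simp add: foldl_replicate_genA[OF assms] genT_eq_Gm_mat Gm_mat_mult[OF assms] add.commute)
  also have "\<dots> = Gm_mat m (int (e + 1 + n))
      (b + of_nat (t mod m) * of_nat m ^ e + of_nat m ^ (e + 1) * of_nat (t div m mod m ^ n))"
    by (rule Suc.IH)
  finally show ?case unfolding digits by simp
qed

lemma length_digit_word: "m > 0 \<Longrightarrow> length (digit_word m n t) \<le> n * m"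
proof (induction n arbitrary: t)
  case 0
  then show ?case by simp
next
  case (Suc n)
  have "t mod m < m" "length (digit_word m n (t div m)) \<le> n * m" using Suc by auto
  then show ?case by (simp; linarith)
qed

lemma set_digit_word: "set (digit_word m n t) \<subseteq> gens m"
  by (induction n arbitrary: t) (auto simp: gens_def)

subsection \<open>The diameter is comparable to the order of m modulo N\<close>

lemma less_power_ord:
  fixes m N :: nat
  assumes "m \<ge> 2" "coprime N m"
  shows "N < m ^ ord N m"
proof -
  have pos: "m ^ ord N m - 1 > 0"
    using one_less_power[of m "ord N m"] ord_pos[OF assms(2)] assms(1) by simp
  moreover have "N dvd m ^ ord N m - 1" using cong_to_1_nat[OF ord[of m N]] .
  ultimately have "N \<le> m ^ ord N m - 1" by (rule dvd_imp_le[rotated])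
  then show ?thesis using pos by arith
qed

text \<open>Modulo G_m(N), the exponent of g^(-1) g' only matters modulo ord N m and its translation
  part in Z[1/m] may be replaced by an integer t < N < m^(ord N m), which the word spells by its
  ord N m base-m digits.\<close>

lemma short_word_between_cosets:
  assumes "m \<ge> 2" "coprime N m" "g \<in> Gm m" "g' \<in> Gm m"
  obtains w where "length w \<le> (m + 1) * ord N m" "set w \<subseteq> gens m"
    "lcoset m N (foldl (**) g w) = lcoset m N g'"
proof -
  have m0: "m > 0" using assms by simp
  define od where "od = ord N m"
  have "od > 0" using ord_pos[OF assms(2)] od_def by simp
  obtain k r where g: "g = Gm_mat m k r" "r \<in> Zinv m" using assms(3) mem_Gm_iff by blast
  obtain k' r' where g': "g' = Gm_mat m k' r'" "r' \<in> Zinv m" using assms(4) mem_Gm_iff by blast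
  define q where "q = (r' - r) * of_nat m powi (- k)"
  have "q \<in> Zinv m"
    unfolding q_def using Zinv_mult[OF Zinv_diff[OF m0 g'(2) g(2)] Zinv_powi[OF m0]] .
  then obtain t where t: "t < N" "q - of_nat t \<in> NZinv m N"
    using Zinv_cong_nat[OF assms(1,2)] by blast
  define j where "j = nat ((k' - k) mod int od)"
  have j: "j < od" "int od dvd k' - k - int j"
    unfolding j_def using \<open>od > 0\<close> by (simp_all add: nat_less_iff mod_eq_dvd_iff[symmetric])
  define w where "w = digit_word m od t @ replicate j (genT m)"
  have "t mod m ^ od = t" using less_power_ord[OF assms(1,2)] t(1) unfolding od_def by simp
  then have "foldl (**) (mat 1) w = Gm_mat m (int od + int j) (of_nat t)"
    unfolding w_def foldl_append mat_1_eq_Gm_mat[of m]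
    using foldl_digit_word[OF m0, of 0 0 od t] foldl_replicate_genT[OF m0] by simp
  then have w_val: "foldl (**) g w = Gm_mat m (k + (int od + int j)) (of_nat m powi k * of_nat t + r)"
    by (subst foldl_matrix_mult) (simp add: g Gm_mat_mult[OF m0])
  have "int od dvd (k + (int od + int j)) - k'"
    using dvd_diff[OF dvd_refl[of "int od"] j(2)] by (simp add: algebra_simps)
  moreover have "(of_nat m powi k * of_nat t + r) - r' = - ((q - of_nat t) * of_nat m powi k)"
    using m0 by (simp add: q_def power_int_minus field_simps)
  then have "(of_nat m powi k * of_nat t + r) - r' \<in> NZinv m N"
    using NZinv_uminus[OF NZinv_mult_Zinv[OF t(2) Zinv_powi[OF m0]]] by simp
  ultimately have "lcoset m N (foldl (**) g w) = lcoset m N g'"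
    unfolding w_val g'(1)
    using lcoset_Gm_mat_eq_iff[OF assms(1,2) Zinv_add[OF m0 Zinv_powi_mult[OF m0 Zinv_of_nat] g(2)] g'(2)]
    by (simp add: od_def)
  moreover have "length w \<le> (m + 1) * od"
    using length_digit_word[OF m0, of od t] j(1) by (simp add: w_def algebra_simps)
  moreover have "set w \<subseteq> gens m" unfolding w_def using set_digit_word by (auto simp: gens_def)
  ultimately show ?thesis using that unfolding od_def by blast
qed

lemma cay_dist_le_length:
  assumes "set w \<subseteq> gens m" "lcoset m N (foldl (**) g w) = lcoset m N g'"
  shows "cay_dist m N g g' \<le> length w"
  unfolding cay_dist_def using assms by (intro Least_le) blast

lemma cay_dist_attained:
  assumes "set w \<subseteq> gens m" "lcoset m N (foldl (**) g w) = lcoset m N g'"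
  obtains w' where "length w' = cay_dist m N g g'" "set w' \<subseteq> gens m"
    "lcoset m N (foldl (**) g w') = lcoset m N g'"
  using LeastI_ex[of "\<lambda>n. \<exists>w. length w = n \<and> set w \<subseteq> gens m \<and>
    lcoset m N (foldl (**) g w) = lcoset m N g'"] assms that
  unfolding cay_dist_def by blast

lemma cay_dist_le:
  assumes "m \<ge> 2" "coprime N m" "g \<in> Gm m" "g' \<in> Gm m"
  shows "cay_dist m N g g' \<le> (m + 1) * ord N m"
proof -
  obtain w where "length w \<le> (m + 1) * ord N m" "set w \<subseteq> gens m"
    "lcoset m N (foldl (**) g w) = lcoset m N g'"
    using short_word_between_cosets[OF assms] .
  then show ?thesis using cay_dist_le_length[of w m N g g'] by linarith
qed

lemma mat_1_mem_Gm: "m \<ge> 2 \<Longrightarrow> mat 1 \<in> Gm m"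
  using Gm_mat_mem_Gm_iff[of m 0 0] mat_1_eq_Gm_mat[of m] Zinv_of_int[of 0 m] by simp

lemma cay_diam_le:
  assumes "m \<ge> 2" "coprime N m"
  shows "cay_diam m N \<le> (m + 1) * ord N m"
  unfolding cay_diam_def using cay_dist_le[OF assms] mat_1_mem_Gm[OF assms(1)]
  by (intro cSup_least) auto

lemma cay_dist_le_cay_diam:
  assumes "m \<ge> 2" "coprime N m" "g \<in> Gm m" "g' \<in> Gm m"
  shows "cay_dist m N g g' \<le> cay_diam m N"
  unfolding cay_diam_def using assms cay_dist_le[OF assms(1,2)]
  by (intro cSup_upper bdd_aboveI[of _ "(m + 1) * ord N m"]) auto

lemma le_abs_of_dvd_diff:
  fixes e j :: int
  assumes "n dvd e - j" "0 \<le> j" "2 * j \<le> n"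
  shows "j \<le> \<bar>e\<bar>"
proof -
  obtain c where c: "e - j = n * c" using assms(1) by blast
  consider "c = 0" | "c \<ge> 1" | "c \<le> -1" by linarith
  then show ?thesis
  proof cases
    case 2
    then have "n * c \<ge> n" using assms by (simp add: mult_le_cancel_left1)
    then show ?thesis using c assms by linarith
  next
    case 3
    then have "n * c \<le> - n" using assms mult_left_mono[of c "-1" n] by simp
    then show ?thesis using c assms by linarith
  qed (use c in simp)
qed

text \<open>A word reaching (m^j, 1; 0, 1), j = ord N m div 2, modulo G_m(N) from the identity is
  nonempty (A is not in G_m(N) as N does not divide 1) and its total T-exponent is congruent
  to j modulo ord N m.\<close>

lemma ord_le_3_length:
  assumes "m \<ge> 2" "coprime N m" "N \<ge> 2" "set w \<subseteq> gens m"
    and "lcoset m N (foldl (**) (mat 1) w) = lcoset m N (Gm_mat m (int (ord N m div 2)) 1)"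
  shows "ord N m \<le> 3 * length w"
proof -
  obtain e s where es: "foldl (**) (Gm_mat m 0 0) w = Gm_mat m e s" "\<bar>e\<bar> \<le> int (length w)"
    "s \<in> Zinv m"
    using foldl_gens_Gm_mat[OF assms(1,4) Zinv_of_int[of 0 m], where k = 0] by auto
  then have "int (ord N m) dvd e - int (ord N m div 2)" "s - 1 \<in> NZinv m N"
    using assms(5) lcoset_Gm_mat_eq_iff[OF assms(1,2) es(3) Zinv_of_int[of 1]]
    by (simp_all add: mat_1_eq_Gm_mat[of m])
  have "w \<noteq> []"
  proof
    assume "w = []"
    then have "of_int (- 1) \<in> NZinv m N"
      using es(1) \<open>s - 1 \<in> NZinv m N\<close> Gm_mat_eq_iff[OF assms(1)] by simp
    then have "int N dvd - 1" using of_int_in_NZinv_iff[OF assms(2), of "- 1"] by simp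
    then show False using assms(3) by simp
  qed
  moreover have "int (ord N m div 2) \<le> \<bar>e\<bar>"
    using le_abs_of_dvd_diff[OF \<open>int (ord N m) dvd _\<close>] by simp
  ultimately show ?thesis using es(2) by (cases w) auto
qed

lemma ord_le_3_cay_diam:
  assumes "m \<ge> 2" "coprime N m" "N \<ge> 2"
  shows "ord N m \<le> 3 * cay_diam m N"
proof -
  let ?g = "Gm_mat m (int (ord N m div 2)) 1"
  have "?g \<in> Gm m" using Gm_mat_mem_Gm_iff[OF assms(1)] Zinv_of_int[of 1] by simp
  then obtain w where "set w \<subseteq> gens m" "lcoset m N (foldl (**) (mat 1) w) = lcoset m N ?g"
    using short_word_between_cosets[OF assms(1,2) mat_1_mem_Gm[OF assms(1)]] by metis
  then obtain w' where "length w' = cay_dist m N (mat 1) ?g" "set w' \<subseteq> gens m"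
    "lcoset m N (foldl (**) (mat 1) w') = lcoset m N ?g"
    by (rule cay_dist_attained)
  then have "ord N m \<le> 3 * cay_dist m N (mat 1) ?g"
    using ord_le_3_length[OF assms] by metis
  also have "\<dots> \<le> 3 * cay_diam m N"
    using cay_dist_le_cay_diam[OF assms(1,2) mat_1_mem_Gm[OF assms(1)] \<open>?g \<in> Gm m\<close>] by simp
  finally show ?thesis .
qed

subsection \<open>From the diameter to the order\<close>

lemma powr_mult_le_self_iff:
  fixes \<alpha> K x n :: real
  assumes "0 < \<alpha>" "\<alpha> < 1" "K > 0" "x > 0" "n > 0"
  shows "K * (x * n) powr \<alpha> \<le> x \<longleftrightarrow> K powr (1 / (1 - \<alpha>)) * n powr (\<alpha> / (1 - \<alpha>)) \<le> x"
proof -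
  have "K * (x * n) powr \<alpha> \<le> x \<longleftrightarrow> (K * n powr \<alpha>) * x powr \<alpha> \<le> x powr (1 - \<alpha>) * x powr \<alpha>"
    using assms by (simp add: powr_mult powr_add[symmetric] mult_ac)
  also have "\<dots> \<longleftrightarrow> K * n powr \<alpha> \<le> x powr (1 - \<alpha>)"
    using assms by simp
  also have "\<dots> \<longleftrightarrow> (K * n powr \<alpha>) powr (1 / (1 - \<alpha>)) \<le> x"
  proof
    assume "K * n powr \<alpha> \<le> x powr (1 - \<alpha>)"
    then have "(K * n powr \<alpha>) powr (1 / (1 - \<alpha>)) \<le> (x powr (1 - \<alpha>)) powr (1 / (1 - \<alpha>))"
      using assms by (intro powr_mono2) auto
    then show "(K * n powr \<alpha>) powr (1 / (1 - \<alpha>)) \<le> x"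
      using assms by (simp add: powr_powr)
  next
    assume "(K * n powr \<alpha>) powr (1 / (1 - \<alpha>)) \<le> x"
    then have "((K * n powr \<alpha>) powr (1 / (1 - \<alpha>))) powr (1 - \<alpha>) \<le> x powr (1 - \<alpha>)"
      using assms by (intro powr_mono2) auto
    then show "K * n powr \<alpha> \<le> x powr (1 - \<alpha>)"
      using assms by (simp add: powr_powr)
  qed
  also have "(K * n powr \<alpha>) powr (1 / (1 - \<alpha>)) = K powr (1 / (1 - \<alpha>)) * n powr (\<alpha> / (1 - \<alpha>))"
    using assms by (simp add: powr_mult powr_powr)
  finally show ?thesis .
qed

lemma comparable_powr_growth_iff:
  fixes \<alpha> a b :: real and D x n :: "nat \<Rightarrow> real"
  assumes "0 < \<alpha>" "\<alpha> < 1" "a > 0" "b > 0" "\<And>k. x k > 0" "\<And>k. n k > 0"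
    and "\<And>k. a * x k \<le> D k" "\<And>k. D k \<le> b * x k"
  shows "(\<exists>C>0. \<forall>k. D k \<ge> C * (x k * n k) powr \<alpha>) \<longleftrightarrow>
    (\<exists>c>0. \<forall>k. x k \<ge> c * n k powr (\<alpha> / (1 - \<alpha>)))"
proof
  assume "\<exists>C>0. \<forall>k. D k \<ge> C * (x k * n k) powr \<alpha>"
  then obtain C where "C > 0" "\<And>k. D k \<ge> C * (x k * n k) powr \<alpha>" by blast
  then have "C * (x k * n k) powr \<alpha> \<le> b * x k" for k
    using assms(8) order_trans by blast
  then have "(C / b) * (x k * n k) powr \<alpha> \<le> x k" for k
    using assms(4) by (simp add: field_simps mult.commute)
  then have "(C / b) powr (1 / (1 - \<alpha>)) * n k powr (\<alpha> / (1 - \<alpha>)) \<le> x k" for k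
    using powr_mult_le_self_iff[OF assms(1,2) divide_pos_pos[OF \<open>C > 0\<close> assms(4)] assms(5,6)] by blast
  then show "\<exists>c>0. \<forall>k. x k \<ge> c * n k powr (\<alpha> / (1 - \<alpha>))"
    using \<open>C > 0\<close> assms(4) by (intro exI[of _ "(C / b) powr (1 / (1 - \<alpha>))"]) auto
next
  assume "\<exists>c>0. \<forall>k. x k \<ge> c * n k powr (\<alpha> / (1 - \<alpha>))"
  then obtain c where "c > 0" "\<And>k. x k \<ge> c * n k powr (\<alpha> / (1 - \<alpha>))" by blast
  moreover have "(c powr (1 - \<alpha>)) powr (1 / (1 - \<alpha>)) = c"
    using assms(2) \<open>c > 0\<close> by (simp add: powr_powr)
  ultimately have "c powr (1 - \<alpha>) * (x k * n k) powr \<alpha> \<le> x k" for k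
    using powr_mult_le_self_iff[OF assms(1,2) _ assms(5,6)] by simp
  then have "a * (c powr (1 - \<alpha>) * (x k * n k) powr \<alpha>) \<le> a * x k" for k
    using assms(3) by simp
  then have "a * c powr (1 - \<alpha>) * (x k * n k) powr \<alpha> \<le> D k" for k
    using assms(7) order_trans unfolding mult.assoc by blast
  then show "\<exists>C>0. \<forall>k. D k \<ge> C * (x k * n k) powr \<alpha>"
    using assms(3) \<open>c > 0\<close> by (intro exI[of _ "a * c powr (1 - \<alpha>)"]) auto
qed

theorem proposition3p4:
  fixes m :: nat and \<alpha> :: real and N :: "nat \<Rightarrow> nat"
  assumes "m \<ge> 2" and "0 < \<alpha>" and "\<alpha> < 1" and "arith_box_seq m N"
  shows "property_D \<alpha> m N \<longleftrightarrow>
    (\<exists>c>0. \<forall>k. real (ord (N k) m) \<ge> c * real (N k) powr (\<alpha> / (1 - \<alpha>)))"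
proof -
  have N: "N k \<ge> 2" "coprime (N k) m" for k
    using assms(4) unfolding arith_box_seq_def by auto
  have lower: "(1 / 3) * real (ord (N k) m) \<le> real (cay_diam m (N k))" for k
    using ord_le_3_cay_diam[OF assms(1) N(2) N(1), of k] by simp
  have upper: "real (cay_diam m (N k)) \<le> (real m + 1) * real (ord (N k) m)" for k
    using of_nat_mono[OF cay_diam_le[OF assms(1) N(2), of k], where 'a = real]
    by (simp add: algebra_simps)
  have pos: "real (ord (N k) m) > 0" "real (N k) > 0" for k
    using ord_pos[OF N(2)] N(1)[of k] by auto
  show ?thesis
    unfolding property_D_def card_quot[OF assms(1) N(2)] of_nat_mult
    by (rule comparable_powr_growth_iff[OF assms(2,3) _ _ pos lower upper]) simp_all
qed

end
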